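(* Let $G$ be a free group of rotations of the sphere $S^2$. If a system of congruences has a solution, or even a quasi-solution, in $S^2$ using nonmeager sets with the property of Baire, with elements of $G$ witnessing the congruences, then the system is weak and consistent.
   Context: Fix a positive integer $r$; for $S\subseteq\{1,\dots,r\}$ write $S^c=\{1,\dots,r\}\setminus S$. A congruence is a pair $(L,R)$ of subsets of $\{1,\dots,r\}$, written formally $\bigcup_{k\in L}A_k\cong\bigcup_{k\in R}A_k$; a system of congruences is a finite list of pairs $(L_i,R_i)$, $i\le m$. The congruences deducible from a system are those obtained from its members (read symmetrically, so $(L,R)$ also gives $(R,L)$) by taking complements ($(L,R)$ gives $(L^c,R^c)$) and transitivity ($(L,M)$ and $(M,R)$ give $(L,R)$). The system is weak if no congruence of the form $(L,L^c)$ is deducible from it. Let $\preceq$ be the smallest transitive relation on subsets of $\{1,\dots,r\}$ such that $L\preceq R$ whenever $L\subseteq R$, and $L_i\preceq R_i$, $R_i\preceq L_i$, $L_i^c\preceq R_i^c$, $R_i^c\preceq L_i^c$ for all $i\le m$. The system is consistent if there are no $L,R$ with $R$ a proper subset of $L$ and $L\preceq R$. A solution to the system in $S^2$ with witnesses in $G$ is a sequence of pairwise disjoint sets $A_1,\dots,A_r$ with union $S^2$ such that for each $i\le m$ there is $\sigma_i\in G$ with $\sigma_i(\bigcup_{k\in L_i}A_k)=\bigcup_{k\in R_i}A_k$. A quasi-solution is a sequence $A_1,\dots,A_r$ of subsets of $S^2$ with pairwise meager intersections and comeager union such that for each $i\le m$ there is $\sigma_i\in G$ for which $\sigma_i(\bigcup_{k\in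 L_i}A_k)$ differs from $\bigcup_{k\in R_i}A_k$ by a meager set. A set has the property of Baire if it differs from an open set by a meager set. *)

theory Defs
  imports "HOL-Algebra.Generated_Groups" "HOL-Analysis.Analysis"
begin

section \<open>Systems of congruences\<close>

text \<open>A congruence is a pair of subsets of \<open>{1..r}\<close>, a system is a finite list of congruences.\<close>

definition congruence_system :: "nat \<Rightarrow> (nat set \<times> nat set) list \<Rightarrow> bool" where
  "congruence_system r sys \<longleftrightarrow> (\<forall>(L, R) \<in> set sys. L \<subseteq> {1..r} \<and> R \<subseteq> {1..r})"

inductive deducible :: "nat \<Rightarrow> (nat set \<times> nat set) list \<Rightarrow> nat set \<Rightarrow> nat set \<Rightarrow> bool"
  for r :: nat and sys :: "(nat set \<times> nat set) list" where
  member: "(L, R) \<in> set sys \<Longrightarrow> deducible r sys L R"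
| member_sym: "(L, R) \<in> set sys \<Longrightarrow> deducible r sys R L"
| compl: "deducible r sys L R \<Longrightarrow> deducible r sys ({1..r} - L) ({1..r} - R)"
| trans: "deducible r sys L M \<Longrightarrow> deducible r sys M R \<Longrightarrow> deducible r sys L R"

definition weak_system :: "nat \<Rightarrow> (nat set \<times> nat set) list \<Rightarrow> bool" where
  "weak_system r sys \<longleftrightarrow> \<not> (\<exists>L\<subseteq>{1..r}. deducible r sys L ({1..r} - L))"

inductive sys_le :: "nat \<Rightarrow> (nat set \<times> nat set) list \<Rightarrow> nat set \<Rightarrow> nat set \<Rightarrow> bool"
  for r :: nat and sys :: "(nat set \<times> nat set) list" where
  subset: "L \<subseteq> R \<Longrightarrow> R \<subseteq> {1..r} \<Longrightarrow> sys_le r sys L R"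
| left_right: "(L, R) \<in> set sys \<Longrightarrow> sys_le r sys L R"
| right_left: "(L, R) \<in> set sys \<Longrightarrow> sys_le r sys R L"
| compl_left_right: "(L, R) \<in> set sys \<Longrightarrow> sys_le r sys ({1..r} - L) ({1..r} - R)"
| compl_right_left: "(L, R) \<in> set sys \<Longrightarrow> sys_le r sys ({1..r} - R) ({1..r} - L)"
| trans: "sys_le r sys L M \<Longrightarrow> sys_le r sys M R \<Longrightarrow> sys_le r sys L R"

definition consistent_system :: "nat \<Rightarrow> (nat set \<times> nat set) list \<Rightarrow> bool" where
  "consistent_system r sys \<longleftrightarrow>
     \<not> (\<exists>L R. L \<subseteq> {1..r} \<and> R \<subset> L \<and> sys_le r sys L R)"


section \<open>Baire category notions\<close>

definition nowhere_dense_in :: "'a topology \<Rightarrow> 'a set \<Rightarrow> bool" where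
  "nowhere_dense_in X N \<longleftrightarrow> N \<subseteq> topspace X \<and> X interior_of (X closure_of N) = {}"

definition meager_in :: "'a topology \<Rightarrow> 'a set \<Rightarrow> bool" where
  "meager_in X M \<longleftrightarrow>
     (\<exists>\<N>. countable \<N> \<and> (\<forall>N\<in>\<N>. nowhere_dense_in X N) \<and> M = \<Union>\<N>)"

definition comeager_in :: "'a topology \<Rightarrow> 'a set \<Rightarrow> bool" where
  "comeager_in X C \<longleftrightarrow> C \<subseteq> topspace X \<and> meager_in X (topspace X - C)"

definition baire_property_in :: "'a topology \<Rightarrow> 'a set \<Rightarrow> bool" where
  "baire_property_in X B \<longleftrightarrow>
     B \<subseteq> topspace X \<and> (\<exists>U. openin X U \<and> meager_in X (sym_diff B U))"


section \<open>Free groups\<close>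

text \<open>
  A word over \<open>X\<close> is a list of pairs: \<open>(x, True)\<close> stands for the letter \<open>x\<close>
  and \<open>(x, False)\<close> for its formal inverse.
\<close>

definition reduced_word :: "('a \<times> bool) list \<Rightarrow> bool" where
  "reduced_word w \<longleftrightarrow>
     successively (\<lambda>a b. \<not> (fst a = fst b \<and> snd a \<noteq> snd b)) w"

definition eval_word :: "('a, 'b) monoid_scheme \<Rightarrow> ('a \<times> bool) list \<Rightarrow> 'a" where
  "eval_word H w =
     foldr (\<lambda>(x, e) y. (if e then x else inv\<^bsub>H\<^esub> x) \<otimes>\<^bsub>H\<^esub> y) w \<one>\<^bsub>H\<^esub>"

definition free_basis :: "('a, 'b) monoid_scheme \<Rightarrow> 'a set \<Rightarrow> bool" where
  "free_basis H X \<longleftrightarrow>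
     X \<subseteq> carrier H \<and> generate H X = carrier H \<and>
     (\<forall>w. reduced_word w \<and> fst ` set w \<subseteq> X \<and> w \<noteq> [] \<longrightarrow> eval_word H w \<noteq> \<one>\<^bsub>H\<^esub>)"

definition free_group :: "('a, 'b) monoid_scheme \<Rightarrow> bool" where
  "free_group H \<longleftrightarrow> group H \<and> (\<exists>X. free_basis H X)"


section \<open>Rotations of the sphere and solutions of systems of congruences\<close>

abbreviation S2 :: "(real ^ 3) set" where
  "S2 \<equiv> sphere 0 1"

abbreviation S2_top :: "(real ^ 3) topology" where
  "S2_top \<equiv> top_of_set S2"

definition SO3 :: "(real ^ 3 ^ 3) monoid" where
  "SO3 = \<lparr>carrier = {Q. rotation_matrix Q}, monoid.mult = (**), one = mat 1\<rparr>"

lemma group_SO3: "group SO3"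
proof (rule groupI)
  fix x assume "x \<in> carrier SO3"
  then have x: "orthogonal_matrix x" "det x = 1"
    by (auto simp: SO3_def rotation_matrix_def)
  then have "transpose x \<in> carrier SO3" "transpose x \<otimes>\<^bsub>SO3\<^esub> x = \<one>\<^bsub>SO3\<^esub>"
    by (auto simp: SO3_def rotation_matrix_def orthogonal_matrix_def det_transpose)
  then show "\<exists>y\<in>carrier SO3. y \<otimes>\<^bsub>SO3\<^esub> x = \<one>\<^bsub>SO3\<^esub>"
    by blast
qed (auto simp: SO3_def rotation_matrix_def orthogonal_matrix_mul det_mul orthogonal_matrix_id
       matrix_mul_assoc)

definition solution ::
  "nat \<Rightarrow> (nat set \<times> nat set) list \<Rightarrow> (real ^ 3 ^ 3) set \<Rightarrow> (nat \<Rightarrow> (real ^ 3) set) \<Rightarrow> bool" where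
  "solution r sys G A \<longleftrightarrow>
     disjoint_family_on A {1..r} \<and> (\<Union>k\<in>{1..r}. A k) = S2 \<and>
     (\<forall>(L, R) \<in> set sys. \<exists>\<sigma>\<in>G. (\<lambda>x. \<sigma> *v x) ` (\<Union>k\<in>L. A k) = (\<Union>k\<in>R. A k))"

definition quasi_solution ::
  "nat \<Rightarrow> (nat set \<times> nat set) list \<Rightarrow> (real ^ 3 ^ 3) set \<Rightarrow> (nat \<Rightarrow> (real ^ 3) set) \<Rightarrow> bool" where
  "quasi_solution r sys G A \<longleftrightarrow>
     (\<forall>k\<in>{1..r}. A k \<subseteq> S2) \<and>
     pairwise (\<lambda>j k. meager_in S2_top (A j \<inter> A k)) {1..r} \<and>
     comeager_in S2_top (\<Union>k\<in>{1..r}. A k) \<and>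
     (\<forall>(L, R) \<in> set sys. \<exists>\<sigma>\<in>G.
        meager_in S2_top (sym_diff ((\<lambda>x. \<sigma> *v x) ` (\<Union>k\<in>L. A k)) (\<Union>k\<in>R. A k)))"

end

theory Submission
  imports Defs
begin

text \<open>
  Write \<open>A\<^sub>L\<close> for the union of the pieces with index in \<open>L\<close> and work modulo meager sets.
  Every deduction step composes or inverts witnesses, so a deducible congruence \<open>(L, R)\<close> has a
  single witness \<open>\<sigma>\<close> in \<open>G\<close> with \<open>\<sigma> A\<^sub>L = A\<^sub>R\<close> (\<open>deducible_imp_carries\<close>), and
  \<open>L \<preceq> R\<close> yields a \<open>\<sigma>\<close> in \<open>G\<close> with \<open>\<sigma> A\<^sub>L \<subseteq> A\<^sub>R\<close>
  (\<open>sys_le_imp_carries\<close>).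

  The point is that such a \<open>\<sigma>\<close> cannot move \<open>A\<^sub>L\<close> off itself or shrink it. A free group is
  torsion-free (\<open>free_group_torsion_free\<close>), so \<open>\<sigma>\<close> is trivial or a rotation by an irrational
  multiple of \<open>\<pi>\<close>; either way \<open>\<sigma>\<close> and its inverse are limits of even powers of
  \<open>\<sigma>\<close> (\<open>rotation_in_closure_even_powers\<close>). A set with the property of Baire that is
  mapped into itself, modulo meager sets, by an isometry is also mapped into itself by every limit of
  iterates of that isometry (\<open>almost_invariant_orbit_closure\<close>), because the largest open set
  almost contained in it is genuinely invariant.

  If \<open>\<sigma> A\<^sub>L\<close> is the complement of \<open>A\<^sub>L\<close>, then \<open>\<sigma>\<^sup>2\<close> preserves \<open>A\<^sub>L\<close>, hence so does
  \<open>\<sigma>\<close>, and both \<open>A\<^sub>L\<close> and its complement are meager. If \<open>\<sigma> A\<^sub>L \<subseteq> A\<^sub>R\<close> with \<open>R\<close> a proper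
  subset of \<open>L\<close>, then \<open>\<sigma>\<close> preserves \<open>A\<^sub>L\<close>, hence so does its inverse, and
  \<open>A\<^sub>L = \<sigma> \<sigma>\<^sup>T A\<^sub>L \<subseteq> \<sigma> A\<^sub>L \<subseteq> A\<^sub>R\<close>, so that the pieces with index in \<open>L - R\<close> are meager.
  Both contradict the assumption that no piece is meager.
\<close>


section \<open>Free groups are torsion-free\<close>

lemma eval_word_simps [simp]:
  "eval_word H [] = \<one>\<^bsub>H\<^esub>"
  "eval_word H (p # w) = (if snd p then fst p else inv\<^bsub>H\<^esub> fst p) \<otimes>\<^bsub>H\<^esub> eval_word H w"
  by (auto simp: eval_word_def split: prod.splits)

context group
begin

lemma eval_word_closed:
  "fst ` set w \<subseteq> carrier G \<Longrightarrow> eval_word G w \<in> carrier G"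
  by (induction w) auto

lemma eval_word_append:
  "fst ` set v \<subseteq> carrier G \<Longrightarrow> fst ` set w \<subseteq> carrier G \<Longrightarrow>
     eval_word G (v @ w) = eval_word G v \<otimes> eval_word G w"
  by (induction v) (auto simp: eval_word_closed m_assoc)

lemma eval_word_replicate:
  "fst ` set w \<subseteq> carrier G \<Longrightarrow> eval_word G (concat (replicate n w)) = eval_word G w [^] n"
proof (induction n)
  case (Suc n)
  have "fst ` set (concat (replicate n w)) \<subseteq> carrier G" using Suc.prems by force
  then have "eval_word G (concat (replicate (Suc n) w)) = eval_word G w \<otimes> eval_word G w [^] n"
    using Suc by (simp add: eval_word_append)
  also have "\<dots> = eval_word G w [^] Suc n"
    using Suc.prems by (metis eval_word_closed nat_pow_Suc2)
  finally show ?case .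
qed simp

lemma generate_eval_word:
  assumes "X \<subseteq> carrier G" "g \<in> generate G X"
  obtains w where "fst ` set w \<subseteq> X" "g = eval_word G w"
proof -
  from assms(2) have "\<exists>w. fst ` set w \<subseteq> X \<and> g = eval_word G w"
  proof (induction rule: generate.induct)
    case one
    show ?case by (rule exI[of _ "[]"]) auto
  next
    case (incl h)
    then show ?case using assms(1) by (intro exI[of _ "[(h, True)]"]) auto
  next
    case (inv h)
    then show ?case using assms(1) by (intro exI[of _ "[(h, False)]"]) auto
  next
    case (eng g h)
    then obtain v w where "fst ` set v \<subseteq> X" "g = eval_word G v"
      "fst ` set w \<subseteq> X" "h = eval_word G w" by blast
    then show ?case using assms(1)
      by (intro exI[of _ "v @ w"]) (auto simp: eval_word_append[OF order.trans order.trans] image_Un)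
  qed
  with that show thesis by blast
qed

lemma conj_pow:
  assumes "a \<in> carrier G" "g \<in> carrier G"
  shows "(a \<otimes> g \<otimes> inv a) [^] (n::nat) = a \<otimes> g [^] n \<otimes> inv a"
proof (induction n)
  case (Suc n)
  have "(a \<otimes> g \<otimes> inv a) [^] Suc n = (a \<otimes> g [^] n) \<otimes> (inv a \<otimes> a) \<otimes> (g \<otimes> inv a)"
    using assms by (simp only: nat_pow_Suc Suc) (simp only: m_assoc m_closed inv_closed nat_pow_closed)
  with assms show ?case by (simp add: m_assoc)
qed (use assms in simp)

lemma conj_eq_one_iff:
  assumes "a \<in> carrier G" "g \<in> carrier G"
  shows "a \<otimes> g \<otimes> inv a = \<one> \<longleftrightarrow> g = \<one>"
  using assms by (metis inv_closed inv_inv inv_solve_right' l_one m_closed one_closed r_cancel_one' r_one l_cancel_one)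

end

lemma reduced_concat_replicate:
  assumes "reduced_word w" "w \<noteq> []" "\<not> (fst (last w) = fst (hd w) \<and> snd (last w) \<noteq> snd (hd w))"
  shows "reduced_word (concat (replicate n w))"
proof (induction n)
  case (Suc n)
  have "concat (replicate n w) = [] \<or> hd (concat (replicate n w)) = hd w"
    using assms(2) by (cases n) auto
  with Suc assms show ?case
    by (auto simp: reduced_word_def successively_append_iff)
qed (simp add: reduced_word_def)

lemma not_reduced_word_split:
  assumes "\<not> reduced_word w"
  obtains u x e v where "w = u @ (x, e) # (x, \<not> e) # v"
proof -
  have "\<exists>u x e v. w = u @ (x, e) # (x, \<not> e) # v"
    using assms
  proof (induction w)
    case (Cons p w)
    show ?case
    proof (cases "reduced_word w")
      case True
      with Cons.prems have "w \<noteq> []" "fst p = fst (hd w)" "snd p \<noteq> snd (hd w)"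
        by (auto simp: reduced_word_def successively_Cons)
      then have "p # w = [] @ (fst p, snd p) # (fst p, \<not> snd p) # tl w"
        by (cases w) (auto simp: prod_eq_iff)
      then show ?thesis by blast
    next
      case False
      with Cons.IH obtain u x e v where "w = u @ (x, e) # (x, \<not> e) # v" by blast
      then have "p # w = (p # u) @ (x, e) # (x, \<not> e) # v" by simp
      then show ?thesis by blast
    qed
  qed (simp add: reduced_word_def)
  with that show thesis by blast
qed

text \<open>
  By induction on its length, a word either cancels to a shorter one, or is conjugate to a shorter
  one by its first letter, or is cyclically reduced. In the last case its powers are, as words,
  again reduced, hence nontrivial by freeness; the other two cases are inherited from the shorter
  word, since conjugation preserves triviality of powers.
\<close>

lemma (in group) free_basis_eval_word_pow:
  assumes basis: "free_basis G X"
    and "fst ` set w \<subseteq> X"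
  shows "eval_word G w = \<one> \<or> (\<forall>n\<ge>1. eval_word G w [^] (n::nat) \<noteq> \<one>)"
  using assms(2)
proof (induction w rule: length_induct)
  case (1 w)
  note IH = "1.IH"[rule_format]
  have X: "X \<subseteq> carrier G" using basis by (simp add: free_basis_def)
  consider (empty) "w = []" | (nonreduced) "\<not> reduced_word w"
    | (cyclic) "w \<noteq> []" "reduced_word w" "\<not> (fst (last w) = fst (hd w) \<and> snd (last w) \<noteq> snd (hd w))"
    | (conj) "w \<noteq> []" "fst (last w) = fst (hd w)" "snd (last w) \<noteq> snd (hd w)"
    by blast
  then show ?case
  proof cases
    case empty
    then show ?thesis by simp
  next
    case nonreduced
    then obtain u x e v where w: "w = u @ (x, e) # (x, \<not> e) # v" by (rule not_reduced_word_split)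
    have x: "x \<in> carrier G" and u: "fst ` set u \<subseteq> carrier G" and v: "fst ` set v \<subseteq> carrier G"
      using "1.prems" X by (auto simp: w)
    have "eval_word G ((x, e) # (x, \<not> e) # v) = eval_word G v"
      using x eval_word_closed[OF v] by (auto simp: m_assoc[symmetric])
    then have "eval_word G w = eval_word G (u @ v)"
      using x u v by (simp add: w eval_word_append del: eval_word_simps)
    then show ?thesis using IH[of "u @ v"] "1.prems" by (simp add: w image_Un)
  next
    case cyclic
    have "eval_word G w [^] n \<noteq> \<one>" if "n \<ge> 1" for n :: nat
    proof -
      have "concat (replicate n w) \<noteq> []" using that cyclic(1) by (cases n) auto
      moreover have "fst ` set (concat (replicate n w)) \<subseteq> X" using "1.prems" by force
      ultimately have "eval_word G (concat (replicate n w)) \<noteq> \<one>"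
        using basis reduced_concat_replicate[OF cyclic(2,1,3), of n] by (simp add: free_basis_def)
      then show ?thesis using eval_word_replicate "1.prems" X by (metis order.trans)
    qed
    then show ?thesis by blast
  next
    case conj
    obtain x e where p: "hd w = (x, e)" by (cases "hd w")
    then have q: "last w = (x, \<not> e)" using conj by (cases "last w") auto
    obtain v where w: "w = (x, e) # v @ [(x, \<not> e)]"
    proof -
      have "tl w \<noteq> []" using conj by (cases w) auto
      with conj(1) have "w = hd w # butlast (tl w) @ [last (tl w)]" by simp
      moreover have "last (tl w) = last w" using \<open>tl w \<noteq> []\<close> by (simp add: last_tl)
      ultimately show thesis using that p q by metis
    qed
    have x: "x \<in> carrier G" and v: "fst ` set v \<subseteq> carrier G" "fst ` set v \<subseteq> X"
      using "1.prems" X by (auto simp: w)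
    define a where "a = (if e then x else inv x)"
    have a: "a \<in> carrier G" using x by (simp add: a_def)
    have "eval_word G w = a \<otimes> eval_word G v \<otimes> inv a"
      using x eval_word_closed[OF v(1)] v by (simp add: w a_def eval_word_append m_assoc)
    then show ?thesis using IH[of v] v a eval_word_closed[OF v(1)]
      by (simp add: w conj_pow conj_eq_one_iff)
  qed
qed

lemma free_group_torsion_free:
  assumes "free_group H" "g \<in> carrier H"
  shows "g = \<one>\<^bsub>H\<^esub> \<or> (\<forall>n\<ge>1. g [^]\<^bsub>H\<^esub> (n::nat) \<noteq> \<one>\<^bsub>H\<^esub>)"
proof -
  obtain X where "group H" and X: "free_basis H X" using assms(1) by (auto simp: free_group_def)
  interpret group H by fact
  have "X \<subseteq> carrier H" "g \<in> generate H X" using X assms(2) by (auto simp: free_basis_def)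
  then obtain w where "fst ` set w \<subseteq> X" "g = eval_word H w" by (rule generate_eval_word)
  with free_basis_eval_word_pow[OF X] show ?thesis by blast
qed

section \<open>Rotations as limits of their even powers\<close>

definition axis_rotation :: "real \<Rightarrow> real ^ 3 ^ 3" where
  "axis_rotation t =
     vector [vector [1, 0, 0], vector [0, cos t, - sin t], vector [0, sin t, cos t]]"

lemma axis_rotation_0: "axis_rotation 0 = mat 1"
  by (simp add: axis_rotation_def vec_eq_iff forall_3 mat_def)

lemma axis_rotation_add: "axis_rotation (s + t) = axis_rotation s ** axis_rotation t"
  by (simp add: axis_rotation_def vec_eq_iff forall_3 matrix_matrix_mult_def sum_3 cos_add sin_add)

lemma transpose_axis_rotation: "transpose (axis_rotation t) = axis_rotation (- t)"
  by (simp add: axis_rotation_def vec_eq_iff forall_3 transpose_def)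

lemma axis_rotation_period: "axis_rotation (t + 2 * pi * of_int k) = axis_rotation t"
proof -
  have "axis_rotation (2 * pi * of_int k) = mat 1"
    by (simp add: axis_rotation_def vec_eq_iff forall_3 mat_def)
  then show ?thesis by (simp add: axis_rotation_add)
qed

lemma continuous_axis_rotation: "continuous_on UNIV (\<lambda>t. axis_rotation t *v x)"
proof -
  have "axis_rotation t *v x
      = axis 1 (x $ 1) + cos t *\<^sub>R (axis 2 (x $ 2) + axis 3 (x $ 3))
        + sin t *\<^sub>R (axis 3 (x $ 2) - axis 2 (x $ 3))" for t
    by (simp add: axis_rotation_def vec_eq_iff forall_3 matrix_vector_mult_def sum_3 axis_def)
  then show ?thesis by (simp add: continuous_intros)
qed

lemma matrix_diff_left_distrib:
  fixes A :: "'a::ring_1 ^ 'n ^ 'm"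
  shows "A ** (B - C) = A ** B - A ** C"
  by (vector matrix_matrix_mult_def sum_subtractf[symmetric] right_diff_distrib)

text \<open>
  Euler's theorem. From \<open>Q - 1 = Q (1 - Q\<^sup>T)\<close> and \<open>det Q = 1\<close> one gets
  \<open>det (Q - 1) = det (1 - Q)\<close>, and in odd dimension the right-hand side is
  \<open>- det (Q - 1)\<close>; so 1 is an eigenvalue.
\<close>

lemma rotation_fixes_unit_vector:
  fixes Q :: "real ^ 3 ^ 3"
  assumes "rotation_matrix Q"
  obtains v where "norm v = 1" "Q *v v = v"
proof -
  have Q: "Q ** transpose Q = mat 1" "det Q = 1"
    using assms by (auto simp: rotation_matrix_def orthogonal_matrix_def)
  have "det (Q - mat 1) = det (Q ** (mat 1 - transpose Q))"
    by (simp add: matrix_diff_left_distrib Q)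
  also have "\<dots> = det (transpose (mat 1 - Q))"
    by (simp add: det_mul Q) (simp add: transpose_def mat_def det_3)
  also have "\<dots> = - det (Q - mat 1)"
    by (simp add: det_transpose) (simp add: det_3 mat_def algebra_simps)
  finally have "det (Q - mat 1) = 0" by simp
  then have "\<not> invertible (Q - mat 1)"
    by (simp add: invertible_det_nz)
  then have "\<not> (\<forall>x. (Q - mat 1) *v x = 0 \<longrightarrow> x = 0)"
    by (simp add: invertible_left_inverse matrix_left_invertible_ker)
  then obtain x where "(Q - mat 1) *v x = 0" and "x \<noteq> 0" by blast
  then have "Q *v x = x" by (simp add: matrix_vector_mult_diff_rdistrib)
  then have "Q *v (x /\<^sub>R norm x) = x /\<^sub>R norm x"
    by (simp add: matrix_vector_mult_scaleR)
  with \<open>x \<noteq> 0\<close> show thesis by (intro that[of "x /\<^sub>R norm x"]) auto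
qed

lemma rotation_fixing_axis:
  fixes Q :: "real ^ 3 ^ 3"
  assumes "rotation_matrix Q" "Q *v axis 1 1 = axis 1 1"
  obtains t where "Q = axis_rotation t"
proof -
  have QQ: "transpose Q ** Q = mat 1" "det Q = 1"
    using assms by (auto simp: rotation_matrix_def orthogonal_matrix_def)
  have "transpose Q *v axis 1 1 = transpose Q *v (Q *v axis 1 1)" using assms by simp
  then have "transpose Q *v axis 1 1 = axis 1 1"
    by (simp add: matrix_vector_mul_assoc QQ)
  with assms have col: "Q$1$1 = 1" "Q$2$1 = 0" "Q$3$1 = 0" "Q$1$2 = 0" "Q$1$3 = 0"
    by (auto simp: vec_eq_iff forall_3 matrix_vector_mult_def sum_3 axis_def transpose_def)
  have unit: "(Q$2$2)\<^sup>2 + (Q$3$2)\<^sup>2 = 1" and orth: "Q$2$2 * Q$2$3 + Q$3$2 * Q$3$3 = 0"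
    using QQ(1) col
    by (auto simp: vec_eq_iff forall_3 matrix_matrix_mult_def sum_3 mat_def transpose_def power2_eq_square)
  have det: "Q$2$2 * Q$3$3 - Q$2$3 * Q$3$2 = 1"
    using QQ(2) col by (simp add: det_3)
  have a: "Q$3$3 = Q$2$2" "Q$2$3 = - Q$3$2"
    using unit orth det by algebra+
  from sincos_total_2pi[OF unit] obtain t where "Q$2$2 = cos t" "Q$3$2 = sin t" by metis
  then have "Q = axis_rotation t"
    using a col by (simp add: axis_rotation_def vec_eq_iff forall_3)
  then show thesis by (rule that)
qed

text \<open>
  Every rotation is conjugate to a rotation about the first coordinate axis, so its powers lie in
  a circle group. This is where dimension three enters: on a higher-dimensional torus an element
  of infinite order need not be a limit of its even powers, because a component of order two may
  be present.
\<close>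

lemma rotation_normal_form:
  fixes Q :: "real ^ 3 ^ 3"
  assumes "rotation_matrix Q"
  obtains P t where "rotation_matrix P" "Q = P ** axis_rotation t ** transpose P"
proof -
  obtain v where v: "norm v = 1" "Q *v v = v" using rotation_fixes_unit_vector[OF assms] .
  obtain P where P: "rotation_matrix P" "P *v axis 1 1 = v"
    using rotation_matrix_exists_basis[OF _ v(1), of 1] by auto
  then have PP: "transpose P ** P = mat 1" "P ** transpose P = mat 1"
    by (auto simp: rotation_matrix_def orthogonal_matrix_def)
  let ?R = "transpose P ** Q ** P"
  have "rotation_matrix ?R"
    using P assms by (simp add: rotation_matrix_def orthogonal_matrix_mul det_mul)
  moreover have "?R *v axis 1 1 = axis 1 1"
  proof -
    have "?R *v axis 1 1 = transpose P *v (Q *v (P *v axis 1 1))"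
      by (simp add: matrix_vector_mul_assoc matrix_mul_assoc)
    also have "\<dots> = transpose P *v (P *v axis 1 1)" by (simp add: P v)
    finally show ?thesis by (simp add: matrix_vector_mul_assoc PP)
  qed
  ultimately obtain t where "?R = axis_rotation t" by (rule rotation_fixing_axis)
  then have "P ** axis_rotation t ** transpose P = P ** ?R ** transpose P" by simp
  also have "\<dots> = (P ** transpose P) ** Q ** (P ** transpose P)" by (simp add: matrix_mul_assoc)
  also have "\<dots> = Q" by (simp add: PP)
  finally show thesis using that[OF P(1)] by metis
qed

lemma SO3_simps: "x \<in> carrier SO3 \<longleftrightarrow> rotation_matrix x" "x \<otimes>\<^bsub>SO3\<^esub> y = x ** y" "\<one>\<^bsub>SO3\<^esub> = mat 1"
  by (simp_all add: SO3_def)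

lemma conj_axis_rotation_pow:
  assumes "rotation_matrix P"
  shows "(P ** axis_rotation t ** transpose P) [^]\<^bsub>SO3\<^esub> n = P ** axis_rotation (real n * t) ** transpose P"
proof (induction n)
  case 0
  then show ?case using assms
    by (simp add: SO3_simps axis_rotation_0 rotation_matrix_def orthogonal_matrix_def)
next
  case (Suc n)
  have "(P ** axis_rotation t ** transpose P) [^]\<^bsub>SO3\<^esub> Suc n
      = P ** axis_rotation (real n * t) ** (transpose P ** P) ** axis_rotation t ** transpose P"
    by (simp add: Suc SO3_simps matrix_mul_assoc)
  also have "transpose P ** P = mat 1"
    using assms by (auto simp: rotation_matrix_def orthogonal_matrix_def)
  also have "P ** axis_rotation (real n * t) ** mat 1 ** axis_rotation t ** transpose P
      = P ** (axis_rotation (real n * t) ** axis_rotation t) ** transpose P"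
    by (simp add: matrix_mul_assoc)
  finally show ?case by (simp add: axis_rotation_add[symmetric] algebra_simps)
qed

text \<open>
  If \<open>Q\<close> is the rotation by an angle \<open>t\<close> and has infinite order, then \<open>t / \<pi>\<close>
  is irrational, so by Kronecker's theorem the angles \<open>2 n t\<close> are dense modulo \<open>2 \<pi>\<close>;
  in particular they come close to \<open>t\<close> and to \<open>- t\<close>. Only even powers are taken because
  in a paradoxical congruence \<open>(L, L\<^sup>c)\<close> it is the square of the witness that preserves a set.
\<close>

lemma rotation_in_closure_even_powers:
  assumes rot: "rotation_matrix Q"
    and order: "Q = mat 1 \<or> (\<forall>n\<ge>1. Q [^]\<^bsub>SO3\<^esub> (n::nat) \<noteq> mat 1)"
  shows "Q *v x \<in> closure (range (\<lambda>n::nat. Q [^]\<^bsub>SO3\<^esub> (2 * n) *v x))" (is "_ \<in> closure ?C")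
    and "transpose Q *v x \<in> closure (range (\<lambda>n::nat. Q [^]\<^bsub>SO3\<^esub> (2 * n) *v x))"
proof -
  have "Q *v x \<in> closure ?C \<and> transpose Q *v x \<in> closure ?C"
  proof (cases "Q = mat 1")
    case True
    have "x = Q [^]\<^bsub>SO3\<^esub> (2 * 0 :: nat) *v x" by (simp add: SO3_simps)
    then have "x \<in> closure ?C" by (metis (no_types, lifting) closure_subset rangeI subsetD)
    then show ?thesis by (simp add: True transpose_mat)
  next
    case False
    obtain P t where P: "rotation_matrix P" and Q: "Q = P ** axis_rotation t ** transpose P"
      using rotation_normal_form[OF rot] .
    define R where "R \<tau> = P ** axis_rotation \<tau> ** transpose P" for \<tau>
    have pow: "Q [^]\<^bsub>SO3\<^esub> (n::nat) = R (real n * t)" for n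
      using conj_axis_rotation_pow[OF P] by (simp add: Q R_def)
    have period: "R (\<tau> + 2 * pi * of_int k) = R \<tau>" for \<tau> k
      by (simp add: R_def axis_rotation_period)
    have R0: "R 0 = mat 1"
      using P by (simp add: R_def axis_rotation_0 rotation_matrix_def orthogonal_matrix_def)
    have cont: "continuous_on UNIV (\<lambda>\<tau>. R \<tau> *v x)"
      using continuous_on_compose2[OF matrix_vector_mult_linear_continuous_on
          continuous_axis_rotation[of "transpose P *v x"] subset_UNIV, of P]
      by (simp only: R_def matrix_vector_mul_assoc matrix_mul_assoc)
    have irr: "t / pi \<notin> \<rat>"
    proof
      assume "t / pi \<in> \<rat>"
      then obtain p :: int and q :: nat where "q \<noteq> 0" "t / pi = of_int p / real q"
        unfolding Rats_eq_int_div_nat by blast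
      then have "real (2 * q) * t = 0 + 2 * pi * of_int p"
        using \<open>q \<noteq> 0\<close> by (simp add: field_simps)
      then have "Q [^]\<^bsub>SO3\<^esub> (2 * q) = R (0 + 2 * pi * of_int p)" by (simp only: pow)
      then have "Q [^]\<^bsub>SO3\<^esub> (2 * q) = mat 1" by (simp only: period R0)
      with order False \<open>q \<noteq> 0\<close> show False by auto
    qed
  have dense: "R s *v x \<in> closure ?C" for s
      unfolding closure_approachable
    proof (intro allI impI)
      fix e :: real assume "e > 0"
      then obtain d where "d > 0" and d: "\<And>\<tau>. dist \<tau> s < d \<Longrightarrow> dist (R \<tau> *v x) (R s *v x) < e"
        using cont[unfolded continuous_on_iff, rule_format, of s e] by auto
      obtain h k where "k > 0" and hk: "\<bar>of_int k * (t / pi) - of_int h - s / (2 * pi)\<bar> < d / (2 * pi)"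
        using sequence_of_fractional_parts_is_dense[OF irr, of "d / (2 * pi)" "s / (2 * pi)"] \<open>d > 0\<close>
        by (metis divide_pos_pos pi_gt_zero zero_less_mult_iff zero_less_numeral)
      define n where "n = nat k"
      have n: "real_of_int k = real n" using \<open>k > 0\<close> by (simp add: n_def)
      have "real (2 * n) * t + 2 * pi * of_int (- h) - s
            = 2 * pi * (of_int k * (t / pi) - of_int h - s / (2 * pi))"
        unfolding n by (simp add: field_simps)
      then have "dist (real (2 * n) * t + 2 * pi * of_int (- h)) s
            = 2 * pi * \<bar>of_int k * (t / pi) - of_int h - s / (2 * pi)\<bar>"
        unfolding dist_real_def by (simp only: abs_mult) simp
      also have "\<dots> < d" using hk by (simp add: field_simps)
      finally have "dist (R (real (2 * n) * t) *v x) (R s *v x) < e"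
        using d period[of "real (2 * n) * t" "- h"] by metis
      then have "dist (Q [^]\<^bsub>SO3\<^esub> (2 * n) *v x) (R s *v x) < e" by (simp only: pow)
      then show "\<exists>y\<in>?C. dist y (R s *v x) < e" by blast
    qed
    have "Q = R t" "transpose Q = R (- t)"
      by (simp_all add: Q R_def matrix_transpose_mul transpose_axis_rotation matrix_mul_assoc)
    then show ?thesis using dense by simp
  qed
  then show "Q *v x \<in> closure ?C" "transpose Q *v x \<in> closure ?C" by auto
qed

section \<open>Meager sets and the property of Baire\<close>

lemma meager_in_empty: "meager_in X {}"
  unfolding meager_in_def by (rule exI[of _ "{}"]) auto

lemma meager_in_subset:
  assumes "meager_in X M" "N \<subseteq> M"
  shows "meager_in X N"
proof -
  obtain \<N> where \<N>: "countable \<N>" "\<And>K. K \<in> \<N> \<Longrightarrow> nowhere_dense_in X K" "M = \<Union>\<N>"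
    using assms(1) by (auto simp: meager_in_def)
  have "nowhere_dense_in X (K \<inter> N)" if "K \<in> \<N>" for K
  proof -
    have "X interior_of (X closure_of (K \<inter> N)) \<subseteq> X interior_of (X closure_of K)"
      by (intro interior_of_mono closure_of_mono) auto
    with \<N>(2)[OF that] show ?thesis by (auto simp: nowhere_dense_in_def)
  qed
  moreover have "N = \<Union>((\<lambda>K. K \<inter> N) ` \<N>)" using \<N>(3) assms(2) by blast
  ultimately show ?thesis
    unfolding meager_in_def using \<N>(1) by (intro exI[of _ "(\<lambda>K. K \<inter> N) ` \<N>"]) auto
qed

lemma meager_in_countable_Union:
  assumes "countable \<M>" "\<And>M. M \<in> \<M> \<Longrightarrow> meager_in X M"
  shows "meager_in X (\<Union>\<M>)"
proof -
  obtain F where F: "\<And>M. M \<in> \<M> \<Longrightarrow>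
      countable (F M) \<and> (\<forall>N\<in>F M. nowhere_dense_in X N) \<and> M = \<Union>(F M)"
    using assms(2) unfolding meager_in_def by metis
  have "countable (\<Union>(F ` \<M>))" "\<forall>N\<in>\<Union>(F ` \<M>). nowhere_dense_in X N"
    using F assms(1) by auto
  moreover have "\<Union>\<M> = \<Union>(\<Union>(F ` \<M>))"
  proof -
    have "\<Union>\<M> = (\<Union>M\<in>\<M>. \<Union>(F M))" using F by auto
    then show ?thesis by blast
  qed
  ultimately show ?thesis unfolding meager_in_def by blast
qed

lemma meager_in_Un: "meager_in X M \<Longrightarrow> meager_in X N \<Longrightarrow> meager_in X (M \<union> N)"
  using meager_in_countable_Union[of "{M, N}" X] by auto

lemma meager_in_homeomorphic_image:
  assumes hom: "homeomorphic_map X Y f" and "meager_in X M"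
  shows "meager_in Y (f ` M)"
proof -
  obtain \<N> where \<N>: "countable \<N>" "\<And>K. K \<in> \<N> \<Longrightarrow> nowhere_dense_in X K" "M = \<Union>\<N>"
    using assms(2) by (auto simp: meager_in_def)
  have "nowhere_dense_in Y (f ` K)" if "K \<in> \<N>" for K
  proof -
    have K: "K \<subseteq> topspace X" "X interior_of (X closure_of K) = {}"
      using \<N>(2)[OF that] by (auto simp: nowhere_dense_in_def)
    then have "Y interior_of (Y closure_of (f ` K)) = {}"
      by (simp add: homeomorphic_map_closure_of[OF hom] homeomorphic_map_interior_of[OF hom]
          closure_of_subset_topspace)
    moreover have "f ` K \<subseteq> topspace Y" using K homeomorphic_imp_surjective_map[OF hom] by blast
    ultimately show ?thesis by (simp add: nowhere_dense_in_def)
  qed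
  moreover have "f ` M = \<Union>((`) f ` \<N>)" using \<N>(3) by blast
  ultimately show ?thesis
    unfolding meager_in_def using \<N>(1) by (intro exI[of _ "(`) f ` \<N>"]) auto
qed

lemma baire_property_in_Union:
  assumes "countable \<B>" "\<And>B. B \<in> \<B> \<Longrightarrow> baire_property_in X B"
  shows "baire_property_in X (\<Union>\<B>)"
proof -
  obtain U where U: "\<And>B. B \<in> \<B> \<Longrightarrow> openin X (U B) \<and> meager_in X (sym_diff B (U B))"
    using assms(2) unfolding baire_property_in_def by metis
  have "openin X (\<Union>(U ` \<B>))" using U by auto
  moreover have "meager_in X (\<Union>((\<lambda>B. sym_diff B (U B)) ` \<B>))"
    using assms(1) U by (intro meager_in_countable_Union) auto
  then have "meager_in X (sym_diff (\<Union>\<B>) (\<Union>(U ` \<B>)))"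
    by (rule meager_in_subset) blast
  ultimately show ?thesis
    using assms(2) unfolding baire_property_in_def by blast
qed

text \<open>
  A set with the property of Baire determines a largest open set contained in it up to a meager
  set; second countability reduces the union of all such open sets to a countable one. Unlike
  an arbitrary open set equal to \<open>B\<close> modulo meager sets, this one depends only on the class of
  \<open>B\<close>, so almost invariance of \<open>B\<close> becomes genuine invariance of the open set.
\<close>

lemma baire_property_open_hull:
  fixes S :: "'a::second_countable_topology set"
  assumes "baire_property_in (top_of_set S) B"
  obtains U where "openin (top_of_set S) U" "meager_in (top_of_set S) (U - B)"
    "meager_in (top_of_set S) (B - U)"
    "\<And>W. openin (top_of_set S) W \<Longrightarrow> meager_in (top_of_set S) (W - B) \<Longrightarrow> W \<subseteq> U"
proof -
  define \<W> where "\<W> = {W. openin (top_of_set S) W \<and> meager_in (top_of_set S) (W - B)}"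
  obtain \<W>' where \<W>': "\<W>' \<subseteq> \<W>" "countable \<W>'" "\<Union>\<W>' = \<Union>\<W>"
    using Lindelof_openin[of \<W> S] by (auto simp: \<W>_def)
  obtain V where V: "openin (top_of_set S) V" "meager_in (top_of_set S) (sym_diff B V)"
    using assms by (auto simp: baire_property_in_def)
  show thesis
  proof
    show "openin (top_of_set S) (\<Union>\<W>)" by (rule openin_Union) (simp add: \<W>_def)
    have "meager_in (top_of_set S) (\<Union>((\<lambda>W. W - B) ` \<W>'))"
      using \<W>' by (intro meager_in_countable_Union) (auto simp: \<W>_def)
    then show "meager_in (top_of_set S) (\<Union>\<W> - B)"
      by (rule meager_in_subset) (use \<W>'(3) in blast)
    have "V \<in> \<W>" using V by (auto simp: \<W>_def elim: meager_in_subset)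
    then show "meager_in (top_of_set S) (B - \<Union>\<W>)"
      by (intro meager_in_subset[OF V(2)]) blast
  qed (auto simp: \<W>_def)
qed

text \<open>
  The open hull \<open>U\<close> of \<open>B\<close> satisfies \<open>f U \<subseteq> U\<close> exactly. If \<open>x \<in> U\<close> has a ball of
  radius \<open>e\<close> inside \<open>U\<close>, then, \<open>f\<close> being an isometry of \<open>S\<close> onto itself, the ball of radius
  \<open>e\<close> around \<open>f\<^sup>n x\<close> is in \<open>U\<close> as well; choosing \<open>n\<close> with \<open>f\<^sup>n x\<close> close to \<open>g x\<close>
  puts \<open>g x\<close> into \<open>U\<close>. So inclusion modulo meager sets passes to limits of iterates.
\<close>

lemma almost_invariant_orbit_closure:
  fixes S :: "'a::{metric_space, second_countable_topology} set"
  assumes baire: "baire_property_in (top_of_set S) B"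
    and f: "homeomorphic_map (top_of_set S) (top_of_set S) f"
    and isometry: "\<And>x y. x \<in> S \<Longrightarrow> y \<in> S \<Longrightarrow> dist (f x) (f y) = dist x y"
    and g: "homeomorphic_map (top_of_set S) (top_of_set S) g"
    and clos: "\<And>x. x \<in> S \<Longrightarrow> g x \<in> closure (range (\<lambda>n. (f ^^ n) x))"
    and inv: "meager_in (top_of_set S) (f ` B - B)"
  shows "meager_in (top_of_set S) (g ` B - B)"
proof -
  have fS: "f ` S = S" and gS: "g ` S = S"
    using homeomorphic_imp_surjective_map[OF f] homeomorphic_imp_surjective_map[OF g] by auto
  obtain U where U: "openin (top_of_set S) U" "meager_in (top_of_set S) (U - B)"
      "meager_in (top_of_set S) (B - U)"
    and max: "\<And>W. openin (top_of_set S) W \<Longrightarrow> meager_in (top_of_set S) (W - B) \<Longrightarrow> W \<subseteq> U"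
    using baire_property_open_hull[OF baire] by blast
  have US: "U \<subseteq> S" using U(1) openin_imp_subset by blast
  have "f ` U \<subseteq> U"
  proof (rule max)
    show "openin (top_of_set S) (f ` U)"
      using homeomorphic_map_openness_eq[OF f] U(1) by blast
    show "meager_in (top_of_set S) (f ` U - B)"
      by (rule meager_in_subset[OF meager_in_Un[OF meager_in_homeomorphic_image[OF f U(2)] inv]]) blast
  qed
  then have fnU: "(f ^^ n) ` U \<subseteq> U" for n by (induction n) auto
  have fnS: "(f ^^ n) ` S = S" for n by (induction n, simp, simp only: funpow.simps image_comp[symmetric] fS)
  have fn_isometry: "dist ((f ^^ n) x) ((f ^^ n) y) = dist x y" if "x \<in> S" "y \<in> S" for n x y
  proof -
    have "(f ^^ n) z \<in> S" if "z \<in> S" for n z using fnS[of n] that by blast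
    then show ?thesis using that by (induction n) (simp_all add: isometry)
  qed
  have "g ` U \<subseteq> U"
  proof clarify
    fix x assume "x \<in> U"
    then have "x \<in> S" "g x \<in> S" using US gS by auto
    obtain e where "e > 0" and e: "\<And>y. y \<in> S \<Longrightarrow> dist y x < e \<Longrightarrow> y \<in> U"
      using U(1) \<open>x \<in> U\<close> by (metis openin_euclidean_subtopology_iff)
    obtain n where n: "dist ((f ^^ n) x) (g x) < e"
      using clos[OF \<open>x \<in> S\<close>] \<open>e > 0\<close> by (auto simp: closure_approachable)
    obtain y where y: "y \<in> S" "g x = (f ^^ n) y" using fnS[of n] \<open>g x \<in> S\<close> by blast
    then have "dist y x < e" using n fn_isometry[OF \<open>x \<in> S\<close> y(1)] by (simp add: dist_commute)
    then have "y \<in> U" using e y by blast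
    then show "g x \<in> U" using fnU[of n] y by blast
  qed
  then have "g ` B - B \<subseteq> g ` (B - U) \<union> (U - B)" by blast
  then show ?thesis
    by (rule meager_in_subset[OF meager_in_Un[OF meager_in_homeomorphic_image[OF g U(3)] U(2)]])
qed

section \<open>Rotations acting on the sphere\<close>

lemma inv_SO3: "rotation_matrix Q \<Longrightarrow> inv\<^bsub>SO3\<^esub> Q = transpose Q"
  by (rule group.inv_equality[OF group_SO3])
     (auto simp: SO3_simps rotation_matrix_def orthogonal_matrix_def det_transpose)

lemma rotation_matrix_transpose: "rotation_matrix Q \<Longrightarrow> rotation_matrix (transpose Q)"
  by (simp add: rotation_matrix_def det_transpose)

lemma dist_rotation:
  fixes Q :: "real ^ 'n ^ 'n"
  assumes "rotation_matrix Q"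
  shows "dist (Q *v x) (Q *v y) = dist x y"
proof -
  have "orthogonal_transformation ((*v) Q)"
    using assms by (simp add: rotation_matrix_def orthogonal_transformation_matrix)
  then show ?thesis
    by (simp add: dist_norm matrix_vector_mult_diff_distrib[symmetric] orthogonal_transformation_norm)
qed

lemma transpose_rotation_cancel:
  fixes Q :: "real ^ 'n ^ 'n"
  assumes "rotation_matrix Q"
  shows "transpose Q *v (Q *v x) = x" "Q *v (transpose Q *v x) = x"
proof -
  have Q: "transpose Q ** Q = mat 1" "Q ** transpose Q = mat 1"
    using assms by (auto simp: rotation_matrix_def orthogonal_matrix_def)
  show "transpose Q *v (Q *v x) = x" "Q *v (transpose Q *v x) = x"
    by (simp_all only: matrix_vector_mul_assoc Q matrix_vector_mul_lid)
qed

lemma homeomorphic_map_rotation: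
  assumes "rotation_matrix Q"
  shows "homeomorphic_map S2_top S2_top ((*v) Q)"
proof -
  have cont: "continuous_map S2_top S2_top ((*v) P)" if "rotation_matrix P" for P
    using dist_rotation[OF that, of _ 0]
    by (auto simp: dist_norm intro!: matrix_vector_mult_linear_continuous_on)
  have "homeomorphic_maps S2_top S2_top ((*v) Q) ((*v) (transpose Q))"
    unfolding homeomorphic_maps_def
    using cont[OF assms] cont[OF rotation_matrix_transpose[OF assms]]
    by (simp only: transpose_rotation_cancel[OF assms]) simp
  then show ?thesis by (rule homeomorphic_maps_imp_map)
qed

lemma meager_in_rotation_imageD:
  assumes "rotation_matrix Q" "meager_in S2_top ((*v) Q ` M)"
  shows "meager_in S2_top M"
proof -
  have "M = (*v) (transpose Q) ` (*v) Q ` M"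
    by (simp only: image_image transpose_rotation_cancel[OF assms(1)]) simp
  then show ?thesis
    using meager_in_homeomorphic_image[OF homeomorphic_map_rotation[OF rotation_matrix_transpose[OF assms(1)]] assms(2)]
    by simp
qed

lemma funpow_matrix_vector: "((*v) Q ^^ n) x = Q [^]\<^bsub>SO3\<^esub> n *v x"
  by (induction n arbitrary: x)
     (simp_all add: SO3_simps funpow_swap1 matrix_vector_mul_assoc del: funpow.simps(2) add: funpow_Suc_right)

lemma solution_imp_quasi_solution:
  assumes "solution r sys G A"
  shows "quasi_solution r sys G A"
proof -
  have A: "disjoint_family_on A {1..r}" "(\<Union>k\<in>{1..r}. A k) = S2"
    and wit: "\<And>L R. (L, R) \<in> set sys \<Longrightarrow> \<exists>\<sigma>\<in>G. (\<lambda>x. \<sigma> *v x) ` (\<Union>k\<in>L. A k) = (\<Union>k\<in>R. A k)"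
    using assms by (auto simp: solution_def)
  have "pairwise (\<lambda>j k. meager_in S2_top (A j \<inter> A k)) {1..r}"
    using A(1) by (auto simp: pairwise_def disjoint_family_on_def meager_in_empty)
  moreover have "comeager_in S2_top (\<Union>k\<in>{1..r}. A k)"
    using A(2) by (simp add: comeager_in_def meager_in_empty)
  moreover have "\<exists>\<sigma>\<in>G. meager_in S2_top
      (sym_diff ((\<lambda>x. \<sigma> *v x) ` (\<Union>k\<in>L. A k)) (\<Union>k\<in>R. A k))" if "(L, R) \<in> set sys" for L R
    using wit[OF that] by (metis Diff_cancel Un_absorb meager_in_empty)
  ultimately show ?thesis unfolding quasi_solution_def using A(2) by blast
qed

section \<open>Congruences modulo meager sets\<close>

text \<open>
  A quasi-solution with its witnesses forgotten.
\<close>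

locale almost_partition =
  fixes r :: nat and A :: "nat \<Rightarrow> (real ^ 3) set"
  assumes subset_sphere: "k \<in> {1..r} \<Longrightarrow> A k \<subseteq> S2"
    and almost_disjoint: "j \<in> {1..r} \<Longrightarrow> k \<in> {1..r} \<Longrightarrow> j \<noteq> k \<Longrightarrow> meager_in S2_top (A j \<inter> A k)"
    and almost_cover: "meager_in S2_top (S2 - (\<Union>k\<in>{1..r}. A k))"
begin

text \<open>
  A one-sided congruence modulo meager sets. An equality of congruent unions is recorded as
  \<open>carries \<sigma> L R\<close> together with \<open>carries \<sigma>\<^sup>T R L\<close>, so that deducibility
  and the preorder of the consistency condition are governed by the same composition rules.
\<close>

definition carries :: "real ^ 3 ^ 3 \<Rightarrow> nat set \<Rightarrow> nat set \<Rightarrow> bool" where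
  "carries \<sigma> L R \<longleftrightarrow> L \<subseteq> {1..r} \<and> R \<subseteq> {1..r} \<and>
     meager_in S2_top ((*v) \<sigma> ` (\<Union>k\<in>L. A k) - (\<Union>k\<in>R. A k))"

lemma almost_disjoint_Union:
  assumes "L \<subseteq> {1..r}" "R \<subseteq> {1..r}" "L \<inter> R = {}"
  shows "meager_in S2_top ((\<Union>k\<in>L. A k) \<inter> (\<Union>k\<in>R. A k))"
proof -
  have "finite L" "finite R" using assms finite_subset by blast+
  then have "countable (\<Union>j\<in>L. \<Union>k\<in>R. {A j \<inter> A k})"
    by (intro countable_finite) auto
  then have "meager_in S2_top (\<Union>(\<Union>j\<in>L. \<Union>k\<in>R. {A j \<inter> A k}))"
    by (rule meager_in_countable_Union) (use assms almost_disjoint in blast)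
  then show ?thesis by (rule meager_in_subset) blast
qed

lemma carries_mono_right: "carries \<sigma> L M \<Longrightarrow> M \<subseteq> R \<Longrightarrow> R \<subseteq> {1..r} \<Longrightarrow> carries \<sigma> L R"
  unfolding carries_def by (blast intro: meager_in_subset)

lemma carries_subset: "L \<subseteq> R \<Longrightarrow> R \<subseteq> {1..r} \<Longrightarrow> carries (mat 1) L R"
  unfolding carries_def by (auto intro: meager_in_subset[OF meager_in_empty])

lemma carries_trans:
  assumes "rotation_matrix \<tau>" "carries \<sigma> L M" "carries \<tau> M R"
  shows "carries (\<tau> ** \<sigma>) L R"
proof -
  let ?A = "\<lambda>L. \<Union>k\<in>L. A k"
  have "meager_in S2_top ((*v) \<tau> ` ((*v) \<sigma> ` ?A L - ?A M) \<union> ((*v) \<tau> ` ?A M - ?A R))"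
    using assms meager_in_homeomorphic_image[OF homeomorphic_map_rotation[OF assms(1)]]
    by (intro meager_in_Un) (auto simp: carries_def)
  then have "meager_in S2_top ((*v) (\<tau> ** \<sigma>) ` ?A L - ?A R)"
    by (rule meager_in_subset) (fastforce simp: matrix_vector_mul_assoc[symmetric])
  then show ?thesis using assms by (simp add: carries_def)
qed

text \<open>
  Modulo meager sets the union over \<open>{1..r} - L\<close> is the complement of the union over \<open>L\<close>, and
  complementation reverses inclusions.
\<close>

lemma carries_compl:
  assumes \<sigma>: "rotation_matrix \<sigma>" and c: "carries \<sigma> L R"
  shows "carries (transpose \<sigma>) ({1..r} - R) ({1..r} - L)"
proof -
  let ?A = "\<lambda>L. \<Union>k\<in>L. A k"
  have LR: "L \<subseteq> {1..r}" "R \<subseteq> {1..r}" using c by (auto simp: carries_def)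
  have "meager_in S2_top (((*v) \<sigma> ` ?A L - ?A R) \<union> (?A R \<inter> ?A ({1..r} - R)))"
    using c LR by (intro meager_in_Un almost_disjoint_Union) (auto simp: carries_def)
  then have "meager_in S2_top
      ((*v) (transpose \<sigma>) ` (((*v) \<sigma> ` ?A L - ?A R) \<union> (?A R \<inter> ?A ({1..r} - R)))
       \<union> (S2 - ?A {1..r}))"
    by (intro meager_in_Un[OF _ almost_cover] meager_in_homeomorphic_image[of S2_top S2_top]
        homeomorphic_map_rotation[OF rotation_matrix_transpose[OF \<sigma>]])
  moreover have "(*v) (transpose \<sigma>) ` ?A ({1..r} - R) - ?A ({1..r} - L)
     \<subseteq> (*v) (transpose \<sigma>) ` (((*v) \<sigma> ` ?A L - ?A R) \<union> (?A R \<inter> ?A ({1..r} - R)))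
       \<union> (S2 - ?A {1..r})"
  proof
    fix x assume x: "x \<in> (*v) (transpose \<sigma>) ` ?A ({1..r} - R) - ?A ({1..r} - L)"
    then obtain y where y: "y \<in> ?A ({1..r} - R)" "x = transpose \<sigma> *v y" by blast
    have "y \<in> S2" using y(1) subset_sphere by blast
    then have "x \<in> S2" using dist_rotation[OF rotation_matrix_transpose[OF \<sigma>], of y 0] y(2) by simp
    moreover have "y \<in> (*v) \<sigma> ` ?A L" if "x \<in> ?A L"
      using that y(2) transpose_rotation_cancel(2)[OF \<sigma>, of y] by (metis imageI)
    ultimately show "x \<in> (*v) (transpose \<sigma>) ` (((*v) \<sigma> ` ?A L - ?A R) \<union> (?A R \<inter> ?A ({1..r} - R)))
       \<union> (S2 - ?A {1..r})"
      using x y by blast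
  qed
  ultimately show ?thesis
    unfolding carries_def using LR by (auto elim: meager_in_subset)
qed

lemma deducible_imp_carries:
  assumes sys: "congruence_system r sys" and G: "subgroup G SO3"
    and wit: "\<And>L R. (L, R) \<in> set sys \<Longrightarrow>
      \<exists>\<sigma>\<in>G. meager_in S2_top (sym_diff ((\<lambda>x. \<sigma> *v x) ` (\<Union>k\<in>L. A k)) (\<Union>k\<in>R. A k))"
    and "deducible r sys L R"
  shows "\<exists>\<sigma>\<in>G. carries \<sigma> L R \<and> carries (transpose \<sigma>) R L"
proof -
  have rot: "rotation_matrix \<sigma>" if "\<sigma> \<in> G" for \<sigma>
    using subgroup.mem_carrier[OF G that] by (simp add: SO3_simps)
  have tr: "transpose \<sigma> \<in> G" if "\<sigma> \<in> G" for \<sigma>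
    using subgroup.m_inv_closed[OF G that] inv_SO3[OF rot[OF that]] by simp
  have mult: "\<tau> ** \<sigma> \<in> G" if "\<tau> \<in> G" "\<sigma> \<in> G" for \<tau> \<sigma>
    using subgroup.m_closed[OF G that] by (simp add: SO3_simps)
  have witnessed: "\<exists>\<sigma>\<in>G. carries \<sigma> L R \<and> carries (transpose \<sigma>) R L" if LR: "(L, R) \<in> set sys" for L R
  proof -
    let ?A = "\<lambda>L. \<Union>k\<in>L. A k"
    obtain \<sigma> where "\<sigma> \<in> G" and m: "meager_in S2_top (sym_diff ((*v) \<sigma> ` ?A L) (?A R))"
      using wit[OF LR] by auto
    have "meager_in S2_top ((*v) (transpose \<sigma>) ` sym_diff ((*v) \<sigma> ` ?A L) (?A R))"
      by (rule meager_in_homeomorphic_image[OF homeomorphic_map_rotation m])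
         (rule rotation_matrix_transpose[OF rot[OF \<open>\<sigma> \<in> G\<close>]])
    moreover have "(*v) (transpose \<sigma>) ` ?A R - ?A L
        \<subseteq> (*v) (transpose \<sigma>) ` sym_diff ((*v) \<sigma> ` ?A L) (?A R)"
    proof
      fix x assume x: "x \<in> (*v) (transpose \<sigma>) ` ?A R - ?A L"
      then obtain y where y: "y \<in> ?A R" "x = transpose \<sigma> *v y" by blast
      have "y \<notin> (*v) \<sigma> ` ?A L"
        using x y(2) transpose_rotation_cancel(1)[OF rot[OF \<open>\<sigma> \<in> G\<close>]] by (metis DiffD2 imageE)
      with y show "x \<in> (*v) (transpose \<sigma>) ` sym_diff ((*v) \<sigma> ` ?A L) (?A R)" by blast
    qed
    ultimately have "meager_in S2_top ((*v) (transpose \<sigma>) ` ?A R - ?A L)"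
      by (rule meager_in_subset)
    moreover have "meager_in S2_top ((*v) \<sigma> ` ?A L - ?A R)"
      using m by (rule meager_in_subset) blast
    ultimately show ?thesis
      using \<open>\<sigma> \<in> G\<close> sys LR by (auto simp: carries_def congruence_system_def)
  qed
  show ?thesis using assms(4)
  proof (induction rule: deducible.induct)
    case (member L R)
    then show ?case by (rule witnessed)
  next
    case (member_sym L R)
    then obtain \<sigma> where "\<sigma> \<in> G" "carries \<sigma> L R" "carries (transpose \<sigma>) R L" using witnessed by blast
    then show ?case using tr[of \<sigma>] by (intro bexI[of _ "transpose \<sigma>"]) auto
  next
    case (compl L R)
    then obtain \<sigma> where \<sigma>: "\<sigma> \<in> G" "carries \<sigma> L R" "carries (transpose \<sigma>) R L" by blast
    then show ?case
      using carries_compl[OF rot[OF \<sigma>(1)] \<sigma>(2)] carries_compl[OF rot[OF tr[OF \<sigma>(1)]] \<sigma>(3)]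
      by auto
  next
    case (trans L M R)
    then obtain \<sigma> \<tau> where \<sigma>: "\<sigma> \<in> G" "carries \<sigma> L M" "carries (transpose \<sigma>) M L"
      and \<tau>: "\<tau> \<in> G" "carries \<tau> M R" "carries (transpose \<tau>) R M" by blast
    then show ?case
      using carries_trans[OF rot[OF \<tau>(1)] \<sigma>(2) \<tau>(2)]
        carries_trans[OF rot[OF tr[OF \<sigma>(1)]] \<tau>(3) \<sigma>(3)] mult[OF \<tau>(1) \<sigma>(1)]
      by (auto simp: matrix_transpose_mul)
  qed
qed

lemma sys_le_imp_carries:
  assumes G: "subgroup G SO3"
    and ded: "\<And>L R. deducible r sys L R \<Longrightarrow> \<exists>\<sigma>\<in>G. carries \<sigma> L R"
    and "sys_le r sys L R"
  shows "\<exists>\<sigma>\<in>G. carries \<sigma> L R"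
  using assms(3)
proof (induction rule: sys_le.induct)
  case (subset L R)
  then show ?case
    using carries_subset subgroup.one_closed[OF G] SO3_simps(3) by metis
next
  case (trans L M R)
  then obtain \<sigma> \<tau> where "\<sigma> \<in> G" "carries \<sigma> L M" "\<tau> \<in> G" "carries \<tau> M R" by blast
  moreover have "rotation_matrix \<tau>" "\<tau> ** \<sigma> \<in> G"
    using subgroup.mem_carrier[OF G \<open>\<tau> \<in> G\<close>] subgroup.m_closed[OF G \<open>\<tau> \<in> G\<close> \<open>\<sigma> \<in> G\<close>]
    by (auto simp: SO3_simps)
  ultimately show ?case using carries_trans by blast
qed (blast intro: ded deducible.intros)+

text \<open>
  A union of pieces almost invariant under \<open>\<sigma>\<^sup>2\<close> is almost invariant under every limit of powers of
  \<open>\<sigma>\<^sup>2\<close>, and if \<open>\<sigma>\<close> is trivial or of infinite order, then \<open>\<sigma>\<close> and its inverse are such limits.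
\<close>

lemma carries_square_imp:
  assumes rot: "rotation_matrix \<sigma>"
    and order: "\<sigma> = mat 1 \<or> (\<forall>n\<ge>1. \<sigma> [^]\<^bsub>SO3\<^esub> (n::nat) \<noteq> mat 1)"
    and baire: "\<And>k. k \<in> {1..r} \<Longrightarrow> baire_property_in S2_top (A k)"
    and c: "carries (\<sigma> ** \<sigma>) L L"
  shows "carries \<sigma> L L" "carries (transpose \<sigma>) L L"
proof -
  have L: "L \<subseteq> {1..r}" and inv: "meager_in S2_top ((*v) (\<sigma> ** \<sigma>) ` (\<Union>k\<in>L. A k) - (\<Union>k\<in>L. A k))"
    using c by (auto simp: carries_def)
  have B: "baire_property_in S2_top (\<Union>k\<in>L. A k)"
    using L baire finite_subset[OF L]
    by (intro baire_property_in_Union) (auto intro: countable_finite)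
  have rot2: "rotation_matrix (\<sigma> ** \<sigma>)"
    using rot by (simp add: rotation_matrix_def orthogonal_matrix_mul det_mul)
  have "(\<sigma> ** \<sigma>) [^]\<^bsub>SO3\<^esub> n = \<sigma> [^]\<^bsub>SO3\<^esub> (2 * n)" for n :: nat
  proof -
    interpret group SO3 by (rule group_SO3)
    have "\<sigma> [^]\<^bsub>SO3\<^esub> (2::nat) = \<sigma> ** \<sigma>"
      using rot by (simp add: numeral_2_eq_2 SO3_simps)
    then show ?thesis using nat_pow_pow[of \<sigma> 2 n] rot by (simp add: SO3_simps)
  qed
  then have iter: "((*v) (\<sigma> ** \<sigma>) ^^ n) x = \<sigma> [^]\<^bsub>SO3\<^esub> (2 * n) *v x" for n x
    by (simp add: funpow_matrix_vector)
  have "carries \<tau> L L" if "rotation_matrix \<tau>"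
    and "\<And>x. \<tau> *v x \<in> closure (range (\<lambda>n::nat. \<sigma> [^]\<^bsub>SO3\<^esub> (2 * n) *v x))" for \<tau>
    using almost_invariant_orbit_closure[OF B homeomorphic_map_rotation[OF rot2]
        dist_rotation[OF rot2] homeomorphic_map_rotation[OF that(1)] _ inv] that(2) L
    by (simp add: iter carries_def)
  then show "carries \<sigma> L L" "carries (transpose \<sigma>) L L"
    using rotation_in_closure_even_powers[OF rot order] rot rotation_matrix_transpose by blast+
qed

end

theorem mainTheorem5:
  fixes r :: nat
    and sys :: "(nat set \<times> nat set) list"
    and G :: "(real ^ 3 ^ 3) set"
  assumes "r \<ge> 1"
    and "congruence_system r sys"
    and "subgroup G SO3"
    and "free_group (SO3\<lparr>carrier := G\<rparr>)"
    and "\<exists>A. (solution r sys G A \<or> quasi_solution r sys G A) \<and>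
             (\<forall>k\<in>{1..r}. \<not> meager_in S2_top (A k) \<and> baire_property_in S2_top (A k))"
  shows "weak_system r sys \<and> consistent_system r sys"
proof -
  obtain A where quasi: "quasi_solution r sys G A"
    and nonmeager: "\<And>k. k \<in> {1..r} \<Longrightarrow> \<not> meager_in S2_top (A k)"
    and baire: "\<And>k. k \<in> {1..r} \<Longrightarrow> baire_property_in S2_top (A k)"
    using assms(5) solution_imp_quasi_solution by blast
  interpret almost_partition r A
    using quasi by unfold_locales (auto simp: quasi_solution_def comeager_in_def pairwise_def)
  have wit: "\<exists>\<sigma>\<in>G. meager_in S2_top (sym_diff ((\<lambda>x. \<sigma> *v x) ` (\<Union>k\<in>L. A k)) (\<Union>k\<in>R. A k))"
    if "(L, R) \<in> set sys" for L R
    using quasi that by (auto simp: quasi_solution_def)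
  note ded = deducible_imp_carries[OF assms(2,3) wit]
  have le: "\<exists>\<sigma>\<in>G. carries \<sigma> L R" if "sys_le r sys L R" for L R
    by (rule sys_le_imp_carries[OF assms(3) _ that]) (use ded in blast)
  have rot: "rotation_matrix \<sigma>" if "\<sigma> \<in> G" for \<sigma>
    using subgroup.mem_carrier[OF assms(3) that] by (simp add: SO3_simps)
  have order: "\<sigma> = mat 1 \<or> (\<forall>n\<ge>1. \<sigma> [^]\<^bsub>SO3\<^esub> (n::nat) \<noteq> mat 1)" if "\<sigma> \<in> G" for \<sigma>
    using free_group_torsion_free[OF assms(4), of \<sigma>] that
    by (simp add: SO3_simps monoid.nat_pow_consistent[OF group.is_monoid[OF group_SO3], symmetric])
  note square = carries_square_imp[OF rot order baire]
  have nonmeager_imp: False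
    if "k \<in> M" "M \<subseteq> {1..r}" "meager_in S2_top (\<Union>k\<in>M. A k)" for k M
    using nonmeager[of k] that meager_in_subset[of S2_top "\<Union>k\<in>M. A k" "A k"] by blast
  have "weak_system r sys"
    unfolding weak_system_def
  proof clarify
    fix L assume L: "L \<subseteq> {1..r}" and "deducible r sys L ({1..r} - L)"
    then obtain \<sigma> where "\<sigma> \<in> G" and \<sigma>: "carries \<sigma> L ({1..r} - L)" "carries (transpose \<sigma>) ({1..r} - L) L"
      using ded by blast
    \<comment> \<open>Complementing the congruence shows that the witness also maps the second half back to the first.\<close>
    have "{1..r} - ({1..r} - L) = L" using L by blast
    then have rev: "carries \<sigma> ({1..r} - L) L"
      using carries_compl[OF rot \<sigma>(1)] \<open>\<sigma> \<in> G\<close>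
       carries_compl[OF rotation_matrix_transpose[OF rot] \<sigma>(2)] by simp
    have "carries \<sigma> L L"
      using square(1) carries_trans[OF rot \<sigma>(1) rev] \<open>\<sigma> \<in> G\<close> by blast
    \<comment> \<open>The image of the first half is almost contained in both halves, which are almost disjoint.\<close>
    then have "meager_in S2_top
        (((*v) \<sigma> ` (\<Union>k\<in>L. A k) - (\<Union>k\<in>L. A k))
         \<union> ((*v) \<sigma> ` (\<Union>k\<in>L. A k) - (\<Union>k\<in>{1..r} - L. A k))
         \<union> ((\<Union>k\<in>L. A k) \<inter> (\<Union>k\<in>{1..r} - L. A k)))"
      using \<sigma>(1) L by (intro meager_in_Un almost_disjoint_Union) (auto simp: carries_def)
    then have "meager_in S2_top ((*v) \<sigma> ` (\<Union>k\<in>L. A k))"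
      by (rule meager_in_subset) blast
    then have "meager_in S2_top (\<Union>k\<in>L. A k)"
      by (rule meager_in_rotation_imageD[OF rot[OF \<open>\<sigma> \<in> G\<close>]])
    then have "L = {}" using nonmeager_imp L by blast
    then have "meager_in S2_top ((*v) \<sigma> ` (\<Union>k\<in>{1..r}. A k))"
      using rev by (simp add: carries_def)
    then have "meager_in S2_top (\<Union>k\<in>{1..r}. A k)"
      by (rule meager_in_rotation_imageD[OF rot[OF \<open>\<sigma> \<in> G\<close>]])
    then show False using nonmeager_imp[of 1 "{1..r}"] assms(1) by simp
  qed
  moreover have "consistent_system r sys"
    unfolding consistent_system_def
  proof (intro notI, elim exE conjE)
    fix L R assume L: "L \<subseteq> {1..r}" and R: "R \<subset> L" and "sys_le r sys L R"
    then obtain \<sigma> where "\<sigma> \<in> G" and \<sigma>: "carries \<sigma> L R"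
      using le by blast
    have "carries \<sigma> L L" using carries_mono_right[OF \<sigma>] R L by blast
    then have "carries (transpose \<sigma>) L L"
      using square(2) carries_trans[OF rot] \<open>\<sigma> \<in> G\<close> by blast
    \<comment> \<open>As the inverse also preserves the larger union, that union is almost contained in its own image.\<close>
    then have "carries (\<sigma> ** transpose \<sigma>) L R"
      using carries_trans[OF rot[OF \<open>\<sigma> \<in> G\<close>]] \<sigma> by blast
    then have "carries (mat 1) L R"
      using rot[OF \<open>\<sigma> \<in> G\<close>] by (simp add: rotation_matrix_def orthogonal_matrix_def)
    then have "meager_in S2_top ((\<Union>k\<in>L. A k) - (\<Union>k\<in>R. A k))"
      by (simp add: carries_def)
    moreover have "meager_in S2_top ((\<Union>k\<in>L - R. A k) \<inter> (\<Union>k\<in>R. A k))"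
      using L R by (intro almost_disjoint_Union) auto
    ultimately have "meager_in S2_top (((\<Union>k\<in>L. A k) - (\<Union>k\<in>R. A k)) \<union> ((\<Union>k\<in>L - R. A k) \<inter> (\<Union>k\<in>R. A k)))"
      by (rule meager_in_Un)
    then have "meager_in S2_top (\<Union>k\<in>L - R. A k)" by (rule meager_in_subset) blast
    then show False using nonmeager_imp[of _ "L - R"] R L by blast
  qed
  ultimately show ?thesis ..
qed

end
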